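(* Let $D$ be a finite set, let $\Gamma$ be a valued constraint language over $D$ with $|\Gamma|$ finite, and let $\Gamma_d$ be the dual of $\Gamma$. For every $k\ge1$ there is a one-to-one correspondence between the $k$-ary fractional polymorphisms of $\Gamma$ and the $k$-ary fractional polymorphisms of $\Gamma_d$, given by $\omega\mapsto\omega_d$ where $\omega_d(f_d)=\omega(f)$ for all $f\in\mathrm{Pol}^{(k)}(\Gamma)$, with $f_d\in\mathrm{Pol}^{(k)}(\Gamma_d)$ the operation on $D'$ obtained by applying $f$ componentwise.
   Context: Let $\overline{\mathbb{Q}}=\mathbb{Q}\cup\{\infty\}$. An $m$-ary cost function over $D$ is a map $\phi:D^m\to\overline{\mathbb{Q}}$, with $\mathrm{Feas}(\phi)=\{\mathbf{x}:\phi(\mathbf{x})<\infty\}$; $\mathbf{x}[i]$ is the $i$th component. An operation $f:D^k\to D$ is a polymorphism of $\phi$ if it maps $k$-tuples of members of $\mathrm{Feas}(\phi)$ (applied componentwise) into $\mathrm{Feas}(\phi)$; $\mathrm{Pol}^{(k)}(\Gamma)$ denotes the $k$-ary common polymorphisms of all members of $\Gamma$. A $k$-ary fractional polymorphism of $\Gamma$ is a probability distribution $\omega:\mathrm{Pol}^{(k)}(\Gamma)\to\mathbb{Q}_{\ge0}$ such that for every $\phi\in\Gamma$ and all $\mathbf{x}_1,\dots,\mathbf{x}_k\in\mathrm{Feas}(\phi)$, $\sum_f\omega(f)\phi(f(\mathbf{x}_1,\dots,\mathbf{x}_k))\le\frac1k\sum_i\phi(\mathbf{x}_i)$. Combined cost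 function: for $\Gamma=\{\phi_1,\dots,\phi_q\}$ (none identically $\infty$) with arities $m_1,\dots,m_q$ and $m=\sum m_i$, $\phi_\Gamma(x_1,\dots,x_m)=\phi_1(x_1,\dots,x_{m_1})+\dots+\phi_q(x_{m-m_q+1},\dots,x_m)$; $D'=\mathrm{Feas}(\phi_\Gamma)$. The dual $\Gamma_d$ is the language over domain $D'$ consisting of the unary function $\phi'_\Gamma(\mathbf{x})=\phi_\Gamma(\mathbf{x})$ ($\mathbf{x}\in D'$) and, for all $i,j\in\{1,\dots,m\}$, the binary relations $\mathrm{match}_{i,j}(\mathbf{x},\mathbf{y})=0$ if $\mathbf{x}[i]=\mathbf{y}[j]$, $\infty$ otherwise. The map $f\mapsto f_d$ is a bijection $\mathrm{Pol}^{(k)}(\Gamma)\to\mathrm{Pol}^{(k)}(\Gamma_d)$.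
   Formalization: Injectivity of f ↦ f_d on the k-ary polymorphisms of Γ is assumed: it can fail (D={0,1}, one unary cost function feasible only at 0, k=1), and then the claimed correspondence fails too. That f_d is a polymorphism of Γ_d and that f ↦ f_d is onto are proved. *)

theory Defs
  imports Complex_Main "HOL-Library.FuncSet" "HOL-Library.NList"
begin

section \<open>Rationals extended by infinity\<close>

datatype qbar = Fin (fin_val: rat) | Infty

instantiation qbar :: comm_monoid_add
begin

definition zero_qbar :: qbar where "0 = Fin 0"

fun plus_qbar :: "qbar \<Rightarrow> qbar \<Rightarrow> qbar" where
  "Fin a + Fin b = Fin (a + b)"
| "Infty + b = Infty"
| "a + Infty = Infty"

instance
proof
  fix a b c :: qbar
  show "a + b + c = a + (b + c)" by (cases a; cases b; cases c) auto
  show "a + b = b + a" by (cases a; cases b) auto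
  show "0 + a = a" by (cases a) (auto simp: zero_qbar_def)
qed

end

section \<open>Cost functions, polymorphisms, fractional polymorphisms\<close>

text \<open>The \<open>m\<close>-tuples over \<open>D\<close> are the lists in \<^term>\<open>nlists m D\<close>, so components are numbered
  from 0. Functions on a set are extensional (\<^term>\<open>undefined\<close> elsewhere), so that equality in HOL
  is equality of functions on that set.\<close>

record 'd cost_fun =
  arity :: nat
  cost :: "'d list \<Rightarrow> qbar"

definition cost_function :: "'d set \<Rightarrow> 'd cost_fun \<Rightarrow> bool" where
  "cost_function D \<phi> \<longleftrightarrow> cost \<phi> \<in> nlists (arity \<phi>) D \<rightarrow>\<^sub>E UNIV"

definition valued_constraint_language :: "'d set \<Rightarrow> 'd cost_fun set \<Rightarrow> bool" where
  "valued_constraint_language D \<Gamma> \<longleftrightarrow> (\<forall>\<phi>\<in>\<Gamma>. cost_function D \<phi>)"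

definition Feas :: "'d set \<Rightarrow> 'd cost_fun \<Rightarrow> 'd list set" where
  "Feas D \<phi> = {x \<in> nlists (arity \<phi>) D. cost \<phi> x \<noteq> Infty}"

definition componentwise :: "('d list \<Rightarrow> 'd) \<Rightarrow> nat \<Rightarrow> 'd list list \<Rightarrow> 'd list" where
  "componentwise f m xs = map (\<lambda>i. f (map (\<lambda>x. x ! i) xs)) [0..<m]"

definition Pol :: "'d set \<Rightarrow> nat \<Rightarrow> 'd cost_fun set \<Rightarrow> ('d list \<Rightarrow> 'd) set" where
  "Pol D k \<Gamma> = {f \<in> nlists k D \<rightarrow>\<^sub>E D.
     \<forall>\<phi>\<in>\<Gamma>. \<forall>xs \<in> nlists k (Feas D \<phi>). componentwise f (arity \<phi>) xs \<in> Feas D \<phi>}"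

text \<open>In the inequality below all costs are finite, as \<open>f\<close> ranges over polymorphisms; so
  \<^const>\<open>fin_val\<close> is only applied to finite values.\<close>

definition fPol :: "'d set \<Rightarrow> nat \<Rightarrow> 'd cost_fun set \<Rightarrow> (('d list \<Rightarrow> 'd) \<Rightarrow> rat) set" where
  "fPol D k \<Gamma> = {\<omega> \<in> Pol D k \<Gamma> \<rightarrow>\<^sub>E {0..}.
     (\<Sum>f\<in>Pol D k \<Gamma>. \<omega> f) = 1 \<and>
     (\<forall>\<phi>\<in>\<Gamma>. \<forall>xs \<in> nlists k (Feas D \<phi>).
        (\<Sum>f\<in>Pol D k \<Gamma>. \<omega> f * fin_val (cost \<phi> (componentwise f (arity \<phi>) xs)))
          \<le> 1 / of_nat k * (\<Sum>i<k. fin_val (cost \<phi> (xs ! i))))}"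

section \<open>The dual language\<close>

text \<open>The combined cost function depends on an enumeration \<open>\<phi>s\<close> of the language.\<close>

fun combined_value :: "'d cost_fun list \<Rightarrow> 'd list \<Rightarrow> qbar" where
  "combined_value [] x = 0"
| "combined_value (\<phi> # \<phi>s) x =
     cost \<phi> (take (arity \<phi>) x) + combined_value \<phi>s (drop (arity \<phi>) x)"

definition total_arity :: "'d cost_fun list \<Rightarrow> nat" where
  "total_arity \<phi>s = (\<Sum>\<phi>\<leftarrow>\<phi>s. arity \<phi>)"

definition combined :: "'d set \<Rightarrow> 'd cost_fun list \<Rightarrow> 'd cost_fun" where
  "combined D \<phi>s =
     \<lparr>arity = total_arity \<phi>s, cost = (\<lambda>x\<in>nlists (total_arity \<phi>s) D. combined_value \<phi>s x)\<rparr>"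

definition dual_dom :: "'d set \<Rightarrow> 'd cost_fun list \<Rightarrow> 'd list set" where
  "dual_dom D \<phi>s = Feas D (combined D \<phi>s)"

definition dual_unary :: "'d set \<Rightarrow> 'd cost_fun list \<Rightarrow> 'd list cost_fun" where
  "dual_unary D \<phi>s =
     \<lparr>arity = 1, cost = (\<lambda>X\<in>nlists 1 (dual_dom D \<phi>s). cost (combined D \<phi>s) (X ! 0))\<rparr>"

definition match :: "'d list set \<Rightarrow> nat \<Rightarrow> nat \<Rightarrow> 'd list cost_fun" where
  "match D' i j =
     \<lparr>arity = 2, cost = (\<lambda>X\<in>nlists 2 D'. if X ! 0 ! i = X ! 1 ! j then 0 else Infty)\<rparr>"

definition dual :: "'d set \<Rightarrow> 'd cost_fun list \<Rightarrow> 'd list cost_fun set" where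
  "dual D \<phi>s = insert (dual_unary D \<phi>s)
     {match (dual_dom D \<phi>s) i j | i j. i < total_arity \<phi>s \<and> j < total_arity \<phi>s}"

definition dual_op ::
  "'d set \<Rightarrow> 'd cost_fun list \<Rightarrow> nat \<Rightarrow> ('d list \<Rightarrow> 'd) \<Rightarrow> ('d list list \<Rightarrow> 'd list)" where
  "dual_op D \<phi>s k f = (\<lambda>X\<in>nlists k (dual_dom D \<phi>s). componentwise f (total_arity \<phi>s) X)"

section \<open>Injectivity of the map on operations\<close>

text \<open>\<^const>\<open>dual_op\<close> only depends on the values of \<open>f\<close> at the \<open>k\<close>-tuples that occur in a single
  component of \<open>k\<close> elements of the dual domain. It is injective if all \<open>k\<close>-tuples occur, but not in
  general: then there need not be any bijection between the fractional polymorphisms.\<close>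

lemma inj_on_dual_op:
  assumes "\<And>t. t \<in> nlists k D \<Longrightarrow>
    \<exists>i < total_arity \<phi>s. \<exists>X \<in> nlists k (dual_dom D \<phi>s). t = map (\<lambda>x. x ! i) X"
  shows "inj_on (dual_op D \<phi>s k) (Pol D k \<Gamma>)"
proof (rule inj_onI)
  fix f g assume f: "f \<in> Pol D k \<Gamma>" and g: "g \<in> Pol D k \<Gamma>"
    and eq: "dual_op D \<phi>s k f = dual_op D \<phi>s k g"
  have "f t = g t" if t: "t \<in> nlists k D" for t
  proof -
    obtain i X where i: "i < total_arity \<phi>s" and X: "X \<in> nlists k (dual_dom D \<phi>s)"
      and tX: "t = map (\<lambda>x. x ! i) X" using assms[OF t] by blast
    have "dual_op D \<phi>s k f X ! i = dual_op D \<phi>s k g X ! i" using eq by simp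
    then show ?thesis using i X tX by (simp add: dual_op_def componentwise_def)
  qed
  then show "f = g" using f g by (intro PiE_ext[of f "nlists k D" "\<lambda>_. D" g]) (auto simp: Pol_def)
qed

lemma dual_op_bijection_fails:
  defines "\<phi> \<equiv> \<lparr>arity = 1, cost = (\<lambda>x\<in>nlists 1 (UNIV :: bool set). if x ! 0 then Infty else 0)\<rparr>"
  shows "cost_function UNIV \<phi>" "Feas UNIV \<phi> \<noteq> {}"
    "\<not> (\<exists>\<Omega>. bij_betw \<Omega> (fPol UNIV 1 {\<phi>}) (fPol (dual_dom UNIV [\<phi>]) 1 (dual UNIV [\<phi>])))"
proof -
  show "cost_function UNIV \<phi>" by (auto simp: \<phi>_def cost_function_def)
  have feas: "Feas UNIV \<phi> = {[False]}"
    by (auto simp: \<phi>_def Feas_def zero_qbar_def in_nlists_Suc_iff)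
  then show "Feas UNIV \<phi> \<noteq> {}" by simp
  have D': "dual_dom UNIV [\<phi>] = {[False]}"
    by (auto simp: \<phi>_def dual_dom_def combined_def total_arity_def Feas_def zero_qbar_def
        in_nlists_Suc_iff)
  have n1: "nlists (Suc 0) A = (\<lambda>a. [a]) ` A" for A :: "'c set"
    by (auto simp: nlists_Suc)
  have ar: "arity \<phi> = 1" by (simp add: \<phi>_def)
  have pol: "Pol UNIV 1 {\<phi>} = {f \<in> nlists 1 UNIV \<rightarrow>\<^sub>E UNIV. f [False] = False}"
    by (simp add: Pol_def feas ar n1 componentwise_def)
  define f where "f = (\<lambda>t\<in>nlists 1 (UNIV :: bool set). False)"
  define g where "g = (\<lambda>t\<in>nlists 1 (UNIV :: bool set). t ! 0)"
  have fg: "f \<in> Pol UNIV 1 {\<phi>}" "g \<in> Pol UNIV 1 {\<phi>}" unfolding pol f_def g_def by (auto simp: n1)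
  have "f [True] \<noteq> g [True]" by (simp add: f_def g_def n1)
  then have fneg: "f \<noteq> g" by metis
  have fin1: "finite (nlists 1 (UNIV :: bool set))"
    by (simp add: nlists_Suc)
  have finPol: "finite (Pol UNIV 1 {\<phi>})"
    unfolding pol by (rule finite_subset[OF _ finite_PiE[OF fin1, of "\<lambda>_. UNIV"]]) auto
  define pm where "pm h = (\<lambda>h'\<in>Pol UNIV 1 {\<phi>}. if h' = h then 1 else 0 :: rat)"
    for h :: "bool list \<Rightarrow> bool"
  have pm: "pm h \<in> fPol UNIV 1 {\<phi>}" if h: "h \<in> Pol UNIV 1 {\<phi>}" for h
  proof -
    have "(\<Sum>h'\<in>Pol UNIV 1 {\<phi>}. pm h h') = (\<Sum>h'\<in>Pol UNIV 1 {\<phi>}. if h' = h then 1 else 0)"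
      by (rule sum.cong) (auto simp: pm_def)
    also have "\<dots> = 1" using h finPol by simp
    finally have "(\<Sum>h'\<in>Pol UNIV 1 {\<phi>}. pm h h') = 1" .
    moreover have "pm h \<in> Pol UNIV 1 {\<phi>} \<rightarrow>\<^sub>E {0..}" by (auto simp: pm_def)
    moreover have "componentwise h' 1 [[False]] = [False]"
      if "h' \<in> Pol UNIV 1 {\<phi>}" for h'
      using that unfolding pol by (simp add: componentwise_def)
    moreover have "fin_val (cost \<phi> [False]) = 0" by (auto simp: \<phi>_def zero_qbar_def n1)
    ultimately show ?thesis
      by (simp add: fPol_def feas ar n1)
  qed
  have "pm f f \<noteq> pm g f" using fg fneg by (simp add: pm_def)
  then have ne: "pm f \<noteq> pm g" by metis
  have Pd: "Pol (dual_dom UNIV [\<phi>]) 1 (dual UNIV [\<phi>]) \<subseteq> {\<lambda>X\<in>{[[False]]}. [False]}"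
  proof
    fix h assume "h \<in> Pol (dual_dom UNIV [\<phi>]) 1 (dual UNIV [\<phi>])"
    then have "h \<in> {[[False]]} \<rightarrow>\<^sub>E {[False]}" by (simp add: Pol_def D' n1)
    then have "h = (\<lambda>X\<in>{[[False]]}. [False])" by (intro PiE_ext[of h _ "\<lambda>_. {[False]}"]) auto
    then show "h \<in> {\<lambda>X\<in>{[[False]]}. [False]}" by simp
  qed
  have one: "w = w'" if w: "w \<in> fPol (dual_dom UNIV [\<phi>]) 1 (dual UNIV [\<phi>])"
    and w': "w' \<in> fPol (dual_dom UNIV [\<phi>]) 1 (dual UNIV [\<phi>])" for w w'
  proof -
    let ?P = "Pol (dual_dom UNIV [\<phi>]) 1 (dual UNIV [\<phi>])"
    have s: "sum w ?P = 1" "sum w' ?P = 1" using w w' by (auto simp: fPol_def)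
    then have "?P \<noteq> {}" by auto
    then obtain p where p: "?P = {p}" using Pd by blast
    have "w p = w' p" using s unfolding p by simp
    moreover have "w \<in> {p} \<rightarrow>\<^sub>E {0..}" "w' \<in> {p} \<rightarrow>\<^sub>E {0..}"
      using w w' unfolding fPol_def p by blast+
    ultimately show ?thesis by (intro PiE_ext[of w "{p}" "\<lambda>_. {0..}" w']) auto
  qed
  show "\<not> (\<exists>\<Omega>. bij_betw \<Omega> (fPol UNIV 1 {\<phi>}) (fPol (dual_dom UNIV [\<phi>]) 1 (dual UNIV [\<phi>])))"
  proof
    assume "\<exists>\<Omega>. bij_betw \<Omega> (fPol UNIV 1 {\<phi>}) (fPol (dual_dom UNIV [\<phi>]) 1 (dual UNIV [\<phi>]))"
    then obtain \<Omega> where b: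
      "bij_betw \<Omega> (fPol UNIV 1 {\<phi>}) (fPol (dual_dom UNIV [\<phi>]) 1 (dual UNIV [\<phi>]))" by blast
    have "\<Omega> (pm f) = \<Omega> (pm g)" using one pm[OF fg(1)] pm[OF fg(2)] bij_betwE[OF b] by blast
    then show False using bij_betw_imp_inj_on[OF b] pm[OF fg(1)] pm[OF fg(2)] ne
      by (auto dest: inj_onD)
  qed
qed

end

theory Submission
  imports Defs
begin

text \<open>An element of the dual domain is a concatenation of feasible tuples, one for each cost
  function, and costs add up over these blocks. An operation \<open>g\<close> on the dual domain preserves all
  relations \<^const>\<open>match\<close> iff component \<open>i\<close> of its value depends only on the components \<open>i\<close> of its
  arguments, through one function \<open>f\<close> not depending on \<open>i\<close>; so \<open>g\<close> is \<open>f\<close> applied componentwise.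
  The inequality of the dual is the sum of the inequalities of the individual cost functions.
  To recover one summand from the sum, put constant tuples at minimisers of the cost in all other
  blocks: there the inequality between the two sides goes the opposite way.\<close>

section \<open>Blocks of the combined cost function\<close>

text \<open>As simplification rules, these loop together with the definition of \<^const>\<open>nlists\<close>.\<close>

declare nlistsE_length [simp del] nlistsE_set [simp del]

lemma length_componentwise [simp]: "length (componentwise f m xs) = m"
  by (simp add: componentwise_def)

lemma componentwise_nth [simp]:
  "i < m \<Longrightarrow> componentwise f m xs ! i = f (map (\<lambda>x. x ! i) xs)"
  by (simp add: componentwise_def)

lemma total_arity_simps [simp]:
  "total_arity [] = 0" "total_arity (\<phi> # \<phi>s) = arity \<phi> + total_arity \<phi>s"
  by (simp_all add: total_arity_def)

text \<open>Closed form of the argument that \<open>combined_value\<close> hands to the cost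
  function at position \<open>p\<close> through its repeated \<open>take\<close> and
  \<open>drop\<close>.\<close>

definition block :: "'d cost_fun list \<Rightarrow> nat \<Rightarrow> 'd list \<Rightarrow> 'd list" where
  "block \<phi>s p x = take (arity (\<phi>s ! p)) (drop (total_arity (take p \<phi>s)) x)"

lemma block_Cons [simp]:
  "block (\<phi> # \<phi>s) 0 x = take (arity \<phi>) x"
  "block (\<phi> # \<phi>s) (Suc p) x = block \<phi>s p (drop (arity \<phi>) x)"
  by (simp_all add: block_def add.commute)

text \<open>Guarantees that \<open>take\<close> and \<open>drop\<close> in \<open>block\<close>
  never run past the end of a tuple of full length; length and entries of a block depend on
  this.\<close>

lemma block_end_le:
  "p < length \<phi>s \<Longrightarrow> total_arity (take p \<phi>s) + arity (\<phi>s ! p) \<le> total_arity \<phi>s"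
proof (induction \<phi>s arbitrary: p)
  case (Cons \<phi> \<phi>s)
  then show ?case by (cases p) auto
qed simp

lemma length_block:
  "p < length \<phi>s \<Longrightarrow> length x = total_arity \<phi>s \<Longrightarrow> length (block \<phi>s p x) = arity (\<phi>s ! p)"
  using block_end_le[of p \<phi>s] by (simp add: block_def)

lemma block_nth:
  "p < length \<phi>s \<Longrightarrow> length x = total_arity \<phi>s \<Longrightarrow> i < arity (\<phi>s ! p) \<Longrightarrow>
    block \<phi>s p x ! i = x ! (total_arity (take p \<phi>s) + i)"
  using block_end_le[of p \<phi>s] by (simp add: block_def)

lemma block_in_nlists:
  assumes "p < length \<phi>s" "x \<in> nlists (total_arity \<phi>s) D"
  shows "block \<phi>s p x \<in> nlists (arity (\<phi>s ! p)) D"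
proof -
  have "set (block \<phi>s p x) \<subseteq> set x"
    unfolding block_def by (meson order_trans set_drop_subset set_take_subset)
  then show ?thesis using assms length_block[of p \<phi>s x] by (auto simp: nlists_def)
qed

text \<open>Cutting out a block only shifts positions, and \<open>componentwise\<close> treats every
  position separately by the same \<open>f\<close>, so the two commute.\<close>

lemma block_componentwise:
  assumes p: "p < length \<phi>s" and X: "\<forall>x\<in>set X. length x = total_arity \<phi>s"
  shows "block \<phi>s p (componentwise f (total_arity \<phi>s) X) =
    componentwise f (arity (\<phi>s ! p)) (map (block \<phi>s p) X)"
proof (rule nth_equalityI)
  show "length (block \<phi>s p (componentwise f (total_arity \<phi>s) X)) =
      length (componentwise f (arity (\<phi>s ! p)) (map (block \<phi>s p) X))"
    using p by (simp add: length_block)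
next
  fix i assume "i < length (block \<phi>s p (componentwise f (total_arity \<phi>s) X))"
  then have i: "i < arity (\<phi>s ! p)" using p by (simp add: length_block)
  have "map (\<lambda>x. x ! (total_arity (take p \<phi>s) + i)) X = map (\<lambda>x. block \<phi>s p x ! i) X"
    using X p i by (simp add: block_nth)
  then show "block \<phi>s p (componentwise f (total_arity \<phi>s) X) ! i =
      componentwise f (arity (\<phi>s ! p)) (map (block \<phi>s p) X) ! i"
    using i p block_end_le[OF p] by (simp add: block_nth o_def del: map_eq_conv)
qed

section \<open>Gluing blocks together\<close>

lemma block_concat:
  assumes "\<forall>q<length \<phi>s. length (y q) = arity (\<phi>s ! q)" "p < length \<phi>s"
  shows "block \<phi>s p (concat (map y [0..<length \<phi>s])) = y p"
  using assms
proof (induction \<phi>s arbitrary: p y)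
  case (Cons \<phi> \<phi>s)
  \<comment> \<open>Peeling off the first block turns the family \<open>y\<close> into
    \<open>y \<circ> Suc\<close>, which is why the induction must generalise over
    \<open>y\<close>.\<close>
  have split: "concat (map y [0..<length (\<phi> # \<phi>s)]) =
      y 0 @ concat (map (y \<circ> Suc) [0..<length \<phi>s])"
    by (simp add: upt_conv_Cons map_Suc_upt[symmetric] del: upt_Suc)
  have len0: "length (y 0) = arity \<phi>" using Cons.prems(1) by force
  show ?case
  proof (cases p)
    case 0
    then show ?thesis using len0 unfolding split by simp
  next
    case (Suc q)
    have "\<forall>q<length \<phi>s. length ((y \<circ> Suc) q) = arity (\<phi>s ! q)" using Cons.prems(1) by force
    then show ?thesis
      using Cons.IH[of "y \<circ> Suc" q] Cons.prems(2) len0 Suc unfolding split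
      by (simp add: o_def)
  qed
qed simp

lemma length_concat_blocks:
  assumes "\<forall>q<length \<phi>s. length (y q) = arity (\<phi>s ! q)"
  shows "length (concat (map y [0..<length \<phi>s])) = total_arity \<phi>s"
proof -
  have "map (length \<circ> y) [0..<length \<phi>s] = map arity \<phi>s"
    using assms by (intro nth_equalityI) auto
  then show ?thesis by (simp add: length_concat total_arity_def)
qed

section \<open>Feasibility and cost, block by block\<close>

lemma combined_value_finite_iff:
  "combined_value \<phi>s x \<noteq> Infty \<longleftrightarrow>
    (\<forall>p<length \<phi>s. cost (\<phi>s ! p) (block \<phi>s p x) \<noteq> Infty)"
proof (induction \<phi>s arbitrary: x)
  case Nil
  show ?case by (simp add: zero_qbar_def)
next
  case (Cons \<phi> \<phi>s)
  have "a + b \<noteq> Infty \<longleftrightarrow> a \<noteq> Infty \<and> b \<noteq> Infty" for a b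
    by (cases a; cases b) auto
  then show ?case using Cons by (simp add: All_less_Suc2)
qed

text \<open>\<open>fin_val\<close> is additive only on finite summands. Finiteness of the whole sum
  passes to the tail, so the induction hypothesis applies.\<close>

lemma fin_val_combined_value:
  "combined_value \<phi>s x \<noteq> Infty \<Longrightarrow>
    fin_val (combined_value \<phi>s x) = (\<Sum>p<length \<phi>s. fin_val (cost (\<phi>s ! p) (block \<phi>s p x)))"
proof (induction \<phi>s arbitrary: x)
  case Nil
  show ?case by (simp add: zero_qbar_def)
next
  case (Cons \<phi> \<phi>s)
  have "fin_val (a + b) = fin_val a + fin_val b \<and> b \<noteq> Infty" if "a + b \<noteq> Infty" for a b
    using that by (cases a; cases b) auto
  then show ?case using Cons by (simp add: sum.lessThan_Suc_shift del: sum.lessThan_Suc)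
qed

text \<open>The dual domain is thus, up to concatenation, the product of the sets of feasible
  tuples: a sum in \<open>qbar\<close> is finite exactly if all summands are, and the blocks of a
  tuple over \<open>D\<close> are automatically tuples over \<open>D\<close>.\<close>

lemma dual_dom_iff:
  "x \<in> dual_dom D \<phi>s \<longleftrightarrow> x \<in> nlists (total_arity \<phi>s) D \<and>
    (\<forall>p<length \<phi>s. block \<phi>s p x \<in> Feas D (\<phi>s ! p))"
proof (cases "x \<in> nlists (total_arity \<phi>s) D")
  case True
  then have "x \<in> dual_dom D \<phi>s \<longleftrightarrow> combined_value \<phi>s x \<noteq> Infty"
    by (simp add: dual_dom_def combined_def Feas_def)
  moreover have "block \<phi>s p x \<in> Feas D (\<phi>s ! p) \<longleftrightarrow> cost (\<phi>s ! p) (block \<phi>s p x) \<noteq> Infty"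
    if "p < length \<phi>s" for p
    using block_in_nlists[OF that True] by (simp add: Feas_def)
  ultimately show ?thesis using True combined_value_finite_iff[of \<phi>s x] by blast
qed (simp add: dual_dom_def combined_def Feas_def)

lemma dual_dom_length: "x \<in> dual_dom D \<phi>s \<Longrightarrow> length x = total_arity \<phi>s"
  unfolding dual_dom_iff by (blast intro: nlistsE_length)

lemma dual_dom_nth: "x \<in> dual_dom D \<phi>s \<Longrightarrow> i < total_arity \<phi>s \<Longrightarrow> x ! i \<in> D"
  unfolding dual_dom_iff by (blast intro: nlistsE_nth_in)

lemma nlists_dual_dom_length:
  "X \<in> nlists k (dual_dom D \<phi>s) \<Longrightarrow> \<forall>x\<in>set X. length x = total_arity \<phi>s"
  by (auto simp: nlists_def dest: dual_dom_length)

lemma map_block_in_nlists: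
  "X \<in> nlists k (dual_dom D \<phi>s) \<Longrightarrow> p < length \<phi>s \<Longrightarrow>
    map (block \<phi>s p) X \<in> nlists k (Feas D (\<phi>s ! p))"
  by (auto simp: nlists_def dual_dom_iff)

lemma fin_val_combined_value_dual_dom:
  "x \<in> dual_dom D \<phi>s \<Longrightarrow>
    fin_val (combined_value \<phi>s x) = (\<Sum>p<length \<phi>s. fin_val (cost (\<phi>s ! p) (block \<phi>s p x)))"
  by (rule fin_val_combined_value)
    (auto simp: combined_value_finite_iff dual_dom_iff Feas_def)

text \<open>In a product the blocks can be prescribed independently. This serves twice: to embed
  \<open>k\<close> feasible tuples of one cost function into the dual domain, and to control what
  the other blocks contribute to the cost.\<close>

lemma ex_dual_tuple_of_block:
  assumes p: "p < length \<phi>s" and xs: "xs \<in> nlists k (Feas D (\<phi>s ! p))"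
    and a: "\<And>q. q < length \<phi>s \<Longrightarrow> a q \<in> Feas D (\<phi>s ! q)"
  obtains X where "X \<in> nlists k (dual_dom D \<phi>s)" "map (block \<phi>s p) X = xs"
    "\<And>q. q < length \<phi>s \<Longrightarrow> q \<noteq> p \<Longrightarrow> map (block \<phi>s q) X = replicate k (a q)"
proof -
  \<comment> \<open>The update \<open>a(p := x)\<close> places \<open>x\<close> in block
    \<open>p\<close> and keeps the fixed tuple \<open>a q\<close> in every other block
    \<open>q\<close>.\<close>
  define glue where "glue x = concat (map (a(p := x)) [0..<length \<phi>s])" for x
  have feas: "(a(p := x)) q \<in> Feas D (\<phi>s ! q)"
    if "x \<in> Feas D (\<phi>s ! p)" "q < length \<phi>s" for x q
    using that a by simp
  have blk: "block \<phi>s q (glue x) = (a(p := x)) q"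
    if "x \<in> Feas D (\<phi>s ! p)" "q < length \<phi>s" for x q
    unfolding glue_def using feas[OF that(1)] that(2)
    by (intro block_concat) (auto simp: Feas_def nlists_def)
  have dom: "glue x \<in> dual_dom D \<phi>s" if x: "x \<in> Feas D (\<phi>s ! p)" for x
  proof -
    have "length (glue x) = total_arity \<phi>s"
      unfolding glue_def using feas[OF x]
      by (intro length_concat_blocks) (auto simp: Feas_def nlists_def)
    moreover have "set (glue x) \<subseteq> D"
    proof
      fix d assume "d \<in> set (glue x)"
      then obtain q where "q < length \<phi>s" "d \<in> set ((a(p := x)) q)"
        unfolding glue_def by (fastforce simp del: fun_upd_apply)
      then show "d \<in> D" using feas[OF x, of q] by (auto simp: Feas_def nlists_def)
    qed
    ultimately show ?thesis using blk[OF x] feas[OF x] by (auto simp: dual_dom_iff nlists_def)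
  qed
  have sxs: "set xs \<subseteq> Feas D (\<phi>s ! p)" "length xs = k" using xs by (auto simp: nlists_def)
  show thesis
  proof
    show "map glue xs \<in> nlists k (dual_dom D \<phi>s)" using sxs dom by (auto simp: nlists_def)
    show "map (block \<phi>s p) (map glue xs) = xs"
      using sxs blk[OF _ p] by (auto intro!: map_idI)
    show "map (block \<phi>s q) (map glue xs) = replicate k (a q)"
      if "q < length \<phi>s" "q \<noteq> p" for q
      using sxs blk[OF _ that(1)] that(2) by (force simp: map_replicate_const[symmetric])
  qed
qed

section \<open>Polymorphisms of the dual\<close>

text \<open>The unary function is finite on its whole domain, since the dual domain consists of the
  feasible tuples of the combined cost function.\<close>

lemma Feas_dual_unary: "Feas (dual_dom D \<phi>s) (dual_unary D \<phi>s) = (\<lambda>x. [x]) ` dual_dom D \<phi>s"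
  by (auto simp: Feas_def[of "dual_dom D \<phi>s"] dual_unary_def in_nlists_Suc_iff)
    (auto simp: dual_dom_def Feas_def)

lemma Feas_match: "Feas D' (match D' i j) = {[x, y] | x y. x \<in> D' \<and> y \<in> D' \<and> x ! i = y ! j}"
  by (auto simp: Feas_def match_def in_nlists_Suc_iff numeral_2_eq_2 zero_qbar_def)

lemma nlists_image: "nlists k (h ` A) = map h ` nlists k A"
proof -
  have eq: "nlists k B = lists B \<inter> {xs. length xs = k}" for B :: "'c set"
    by (auto simp: nlists_def)
  show ?thesis unfolding eq lists_image by auto
qed

text \<open>Transposition: \<open>k\<close> pairs, as fed to a polymorphism of a binary relation,
  become two \<open>k\<close>-tuples, as fed to an operation.\<close>

lemma nlists_pairs_iff:
  "Z \<in> nlists k {[x, y] | x y. x \<in> A \<and> y \<in> A \<and> P x y} \<longleftrightarrow>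
    (\<exists>X\<in>nlists k A. \<exists>Y\<in>nlists k A. (\<forall>l<k. P (X ! l) (Y ! l)) \<and>
      Z = map (\<lambda>l. [X ! l, Y ! l]) [0..<k])"
proof
  assume Z: "Z \<in> nlists k {[x, y] | x y. x \<in> A \<and> y \<in> A \<and> P x y}"
  have elem: "\<exists>x y. Z ! l = [x, y] \<and> x \<in> A \<and> y \<in> A \<and> P x y" if "l < k" for l
    using Z that by (auto simp: nlists_def dest!: subsetD[OF _ nth_mem])
  define X Y where "X = map (\<lambda>l. Z ! l ! 0) [0..<k]" and "Y = map (\<lambda>l. Z ! l ! 1) [0..<k]"
  have "X \<in> nlists k A" "Y \<in> nlists k A"
    using elem by (fastforce simp: nlists_def X_def Y_def)+
  moreover have "P (X ! l) (Y ! l)" if "l < k" for l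
    using elem[OF that] that by (auto simp: X_def Y_def)
  moreover have "Z = map (\<lambda>l. [X ! l, Y ! l]) [0..<k]"
  proof (rule nth_equalityI)
    show "length Z = length (map (\<lambda>l. [X ! l, Y ! l]) [0..<k])" using Z by (simp add: nlists_def)
    fix l assume "l < length Z"
    then have l: "l < k" using Z by (simp add: nlists_def)
    then show "Z ! l = map (\<lambda>l. [X ! l, Y ! l]) [0..<k] ! l"
      using elem[OF l] by (auto simp: X_def Y_def)
  qed
  ultimately show "\<exists>X\<in>nlists k A. \<exists>Y\<in>nlists k A. (\<forall>l<k. P (X ! l) (Y ! l)) \<and>
      Z = map (\<lambda>l. [X ! l, Y ! l]) [0..<k]" by blast
qed (auto simp: nlists_def subset_iff)

lemma match_preserved_iff:
  assumes g: "g \<in> nlists k D' \<rightarrow> D'"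
  shows "(\<forall>Z\<in>nlists k (Feas D' (match D' i j)).
      componentwise g (arity (match D' i j)) Z \<in> Feas D' (match D' i j)) \<longleftrightarrow>
    (\<forall>X\<in>nlists k D'. \<forall>Y\<in>nlists k D'.
      map (\<lambda>x. x ! i) X = map (\<lambda>x. x ! j) Y \<longrightarrow> g X ! i = g Y ! j)"
proof -
  \<comment> \<open>The two columns of the list of pairs are \<open>X\<close> and \<open>Y\<close>,
    so \<open>g\<close> is evaluated once at each.\<close>
  have comp: "componentwise g 2 (map (\<lambda>l. [X ! l, Y ! l]) [0..<k]) = [g X, g Y]"
    if "X \<in> nlists k D'" "Y \<in> nlists k D'" for X Y
  proof -
    have "map (\<lambda>l. X ! l) [0..<k] = X" "map (\<lambda>l. Y ! l) [0..<k] = Y"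
      using that map_nth[of X] map_nth[of Y] by (auto simp: nlists_def)
    then show ?thesis by (simp add: componentwise_def numeral_2_eq_2 o_def)
  qed
  have eq: "map (\<lambda>x. x ! i) X = map (\<lambda>x. x ! j) Y \<longleftrightarrow> (\<forall>l<k. X ! l ! i = Y ! l ! j)"
    if "X \<in> nlists k D'" "Y \<in> nlists k D'" for X Y
    using that by (auto simp: nlists_def list_eq_iff_nth_eq)
  have ar: "arity (match D' i j) = 2" by (simp add: match_def)
  show ?thesis
    unfolding Feas_match nlists_pairs_iff ar
  proof (intro iffI ballI impI)
    fix X Y assume X: "X \<in> nlists k D'" and Y: "Y \<in> nlists k D'"
      and e: "map (\<lambda>x. x ! i) X = map (\<lambda>x. x ! j) Y"
      and *: "\<forall>Z\<in>nlists k {[x, y] |x y. x \<in> D' \<and> y \<in> D' \<and> x ! i = y ! j}.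
        componentwise g 2 Z \<in> {[x, y] |x y. x \<in> D' \<and> y \<in> D' \<and> x ! i = y ! j}"
    have "map (\<lambda>l. [X ! l, Y ! l]) [0..<k] \<in> nlists k {[x, y] |x y. x \<in> D' \<and> y \<in> D' \<and> x ! i = y ! j}"
      unfolding nlists_pairs_iff using X Y e eq[OF X Y] by blast
    then show "g X ! i = g Y ! j" using * comp[OF X Y] by fastforce
  next
    fix Z assume *: "\<forall>X\<in>nlists k D'. \<forall>Y\<in>nlists k D'.
        map (\<lambda>x. x ! i) X = map (\<lambda>x. x ! j) Y \<longrightarrow> g X ! i = g Y ! j"
      and "Z \<in> nlists k {[x, y] |x y. x \<in> D' \<and> y \<in> D' \<and> x ! i = y ! j}"
    then obtain X Y where X: "X \<in> nlists k D'" and Y: "Y \<in> nlists k D'"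
      and e: "\<forall>l<k. X ! l ! i = Y ! l ! j" and Z: "Z = map (\<lambda>l. [X ! l, Y ! l]) [0..<k]"
      unfolding nlists_pairs_iff by blast
    have "g X ! i = g Y ! j" using * X Y e eq[OF X Y] by blast
    then show "componentwise g 2 Z \<in> {[x, y] |x y. x \<in> D' \<and> y \<in> D' \<and> x ! i = y ! j}"
      unfolding Z comp[OF X Y] using g X Y by auto
  qed
qed

text \<open>Every operation on the dual domain preserves the unary function, which is finite
  everywhere. Only the conditions from the relations \<open>match\<close> remain.\<close>

lemma Pol_dual_iff:
  "g \<in> Pol (dual_dom D \<phi>s) k (dual D \<phi>s) \<longleftrightarrow>
    g \<in> nlists k (dual_dom D \<phi>s) \<rightarrow>\<^sub>E dual_dom D \<phi>s \<and>
    (\<forall>i<total_arity \<phi>s. \<forall>j<total_arity \<phi>s.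
      \<forall>X\<in>nlists k (dual_dom D \<phi>s). \<forall>Y\<in>nlists k (dual_dom D \<phi>s).
        map (\<lambda>x. x ! i) X = map (\<lambda>x. x ! j) Y \<longrightarrow> g X ! i = g Y ! j)"
proof (cases "g \<in> nlists k (dual_dom D \<phi>s) \<rightarrow>\<^sub>E dual_dom D \<phi>s")
  case True
  let ?D' = "dual_dom D \<phi>s"
  have g: "g \<in> nlists k ?D' \<rightarrow> ?D'" using True by auto
  have "componentwise g (arity (dual_unary D \<phi>s)) Z \<in> Feas ?D' (dual_unary D \<phi>s)"
    if "Z \<in> nlists k (Feas ?D' (dual_unary D \<phi>s))" for Z
    using that g unfolding Feas_dual_unary nlists_image
    by (auto simp: dual_unary_def componentwise_def o_def)
  then have "g \<in> Pol ?D' k (dual D \<phi>s) \<longleftrightarrow>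
      (\<forall>i<total_arity \<phi>s. \<forall>j<total_arity \<phi>s. \<forall>Z\<in>nlists k (Feas ?D' (match ?D' i j)).
        componentwise g (arity (match ?D' i j)) Z \<in> Feas ?D' (match ?D' i j))"
    using True unfolding Pol_def dual_def by blast
  then show ?thesis using True unfolding match_preserved_iff[OF g] by simp
qed (simp add: Pol_def)

section \<open>Transfer of operations between \<open>D\<close> and the dual domain\<close>

lemma componentwise_in_dual_dom:
  assumes f: "f \<in> Pol D k (set \<phi>s)" and X: "X \<in> nlists k (dual_dom D \<phi>s)"
  shows "componentwise f (total_arity \<phi>s) X \<in> dual_dom D \<phi>s"
  unfolding dual_dom_iff
proof (intro conjI allI impI)
  have "map (\<lambda>x. x ! i) X \<in> nlists k D" if "i < total_arity \<phi>s" for i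
    using X that dual_dom_nth[of _ D \<phi>s i] by (auto simp: nlists_def)
  then show "componentwise f (total_arity \<phi>s) X \<in> nlists (total_arity \<phi>s) D"
    using f by (fastforce simp: Pol_def componentwise_def nlists_def[of "total_arity \<phi>s"])
  \<comment> \<open>By \<open>block_componentwise\<close> this block is \<open>f\<close> applied to
    feasible tuples of the cost function at \<open>p\<close>, which \<open>f\<close>
    preserves.\<close>
  show "block \<phi>s p (componentwise f (total_arity \<phi>s) X) \<in> Feas D (\<phi>s ! p)"
    if p: "p < length \<phi>s" for p
    using f map_block_in_nlists[OF X p] p
    unfolding block_componentwise[OF p nlists_dual_dom_length[OF X]] by (auto simp: Pol_def)
qed

text \<open>Component \<open>i\<close> of the value is \<open>f\<close> at the tuple of components
  \<open>i\<close> of the arguments, so equal tuples of components give equal results, as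
  \<open>match\<close> demands.\<close>

lemma dual_op_in_Pol:
  assumes f: "f \<in> Pol D k (set \<phi>s)"
  shows "dual_op D \<phi>s k f \<in> Pol (dual_dom D \<phi>s) k (dual D \<phi>s)"
  unfolding Pol_dual_iff using componentwise_in_dual_dom[OF f] by (auto simp: dual_op_def)

lemma ex_Pol_dual_op:
  assumes k: "k \<ge> 1" and ne: "\<forall>\<phi>\<in>set \<phi>s. Feas D \<phi> \<noteq> {}"
    and g: "g \<in> Pol (dual_dom D \<phi>s) k (dual D \<phi>s)"
  shows "\<exists>f\<in>Pol D k (set \<phi>s). dual_op D \<phi>s k f = g"
proof -
  let ?D' = "dual_dom D \<phi>s" and ?m = "total_arity \<phi>s"
  have gE: "g \<in> nlists k ?D' \<rightarrow>\<^sub>E ?D'" using g by (simp add: Pol_dual_iff)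
  \<comment> \<open>The graph of the required \<open>f\<close>: \<open>v\<close> is forced at
    \<open>t\<close> if \<open>t\<close> occurs as a component \<open>i\<close> of arguments of
    \<open>g\<close> whose value has \<open>v\<close> there.\<close>
  define rep where "rep t v \<longleftrightarrow>
    (\<exists>i<?m. \<exists>X\<in>nlists k ?D'. t = map (\<lambda>x. x ! i) X \<and> v = g X ! i)" for t v
  \<comment> \<open>Two occurrences of \<open>t\<close>, at components \<open>i\<close> and
    \<open>j\<close>, yield the same value because \<open>g\<close> preserves \<open>match\<close>
    for \<open>i\<close> and \<open>j\<close>.\<close>
  have rep_unique: "v = w" if "rep t v" "rep t w" for t v w
    using g that unfolding rep_def Pol_dual_iff by metis
  have rep_D: "v \<in> D" if "rep t v" for t v
    using that gE dual_dom_nth unfolding rep_def by (fastforce dest: PiE_mem)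
  \<comment> \<open>At tuples that never occur as a component, \<open>g\<close> prescribes nothing.
    The default is the first projection, which lies in \<open>D\<close> because
    \<open>k \<ge> 1\<close> makes \<open>t\<close> nonempty.\<close>
  define f where "f = (\<lambda>t\<in>nlists k D. if \<exists>v. rep t v then THE v. rep t v else hd t)"
  have f_rep: "f t = v" if "rep t v" "t \<in> nlists k D" for t v
  proof -
    have "(THE v. rep t v) = v" using that(1) rep_unique by blast
    then show ?thesis using that unfolding f_def by auto
  qed
  have fE: "f \<in> nlists k D \<rightarrow>\<^sub>E D"
  proof
    fix t assume t: "t \<in> nlists k D"
    show "f t \<in> D"
    proof (cases "\<exists>v. rep t v")
      case True
      then show ?thesis using f_rep rep_D t by blast
    next
      case False
      moreover have "t \<noteq> []" using t k by (auto simp: nlists_def)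
      ultimately show ?thesis using t hd_in_set[of t] by (auto simp: f_def nlists_def)
    qed
  qed (simp add: f_def)
  have fg: "componentwise f ?m X = g X" if X: "X \<in> nlists k ?D'" for X
  proof (rule nth_equalityI)
    show "length (componentwise f ?m X) = length (g X)"
      using dual_dom_length[OF PiE_mem[OF gE X]] by simp
    fix i assume "i < length (componentwise f ?m X)"
    then have i: "i < ?m" by simp
    have "map (\<lambda>x. x ! i) X \<in> nlists k D"
      using X i dual_dom_nth[of _ D \<phi>s i] by (auto simp: nlists_def)
    moreover have "rep (map (\<lambda>x. x ! i) X) (g X ! i)" using i X unfolding rep_def by blast
    ultimately show "componentwise f ?m X ! i = g X ! i" using i f_rep by simp
  qed
  have "f \<in> Pol D k (set \<phi>s)"
    unfolding Pol_def
  proof (intro CollectI conjI ballI fE)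
    fix \<phi> xs assume "\<phi> \<in> set \<phi>s" and xs: "xs \<in> nlists k (Feas D \<phi>)"
    then obtain p where p: "p < length \<phi>s" "\<phi> = \<phi>s ! p" by (auto simp: in_set_conv_nth)
    \<comment> \<open>Some feasible tuple of each cost function is needed to fill the blocks other
      than \<open>p\<close>. Then \<open>xs\<close> is block \<open>p\<close> of tuples
      \<open>X\<close> of the dual domain, and feasibility of the value of \<open>f\<close> is read
      off from \<open>g X\<close>.\<close>
    have "\<forall>\<phi>\<in>set \<phi>s. \<exists>x. x \<in> Feas D \<phi>" using ne by blast
    then obtain a where a: "\<forall>\<phi>\<in>set \<phi>s. a \<phi> \<in> Feas D \<phi>" by (rule bchoice[THEN exE])
    obtain X where X: "X \<in> nlists k ?D'" "map (block \<phi>s p) X = xs"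
      by (rule ex_dual_tuple_of_block[OF p(1) xs[unfolded p(2)], of "\<lambda>q. a (\<phi>s ! q)"])
        (use a in auto)
    have "componentwise f (arity \<phi>) xs = block \<phi>s p (g X)"
      using block_componentwise[OF p(1) nlists_dual_dom_length[OF X(1)], of f] X(2)
      by (simp add: fg[OF X(1)] p(2))
    also have "\<dots> \<in> Feas D \<phi>" using PiE_mem[OF gE X(1)] p by (simp add: dual_dom_iff)
    finally show "componentwise f (arity \<phi>) xs \<in> Feas D \<phi>" .
  qed
  moreover have "dual_op D \<phi>s k f = g"
    using fg PiE_arb[OF gE] by (auto simp: dual_op_def)
  ultimately show ?thesis by blast
qed

lemma bij_betw_dual_op:
  assumes "k \<ge> 1" "\<forall>\<phi>\<in>set \<phi>s. Feas D \<phi> \<noteq> {}" "inj_on (dual_op D \<phi>s k) (Pol D k (set \<phi>s))"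
  shows "bij_betw (dual_op D \<phi>s k) (Pol D k (set \<phi>s)) (Pol (dual_dom D \<phi>s) k (dual D \<phi>s))"
  using assms dual_op_in_Pol ex_Pol_dual_op[OF assms(1,2)]
  unfolding bij_betw_def by blast

section \<open>Fractional polymorphisms of the dual\<close>

text \<open>A relation \<open>match\<close> has cost 0 on its feasible pairs, and polymorphisms stay
  among these, so its inequality reads \<open>0 \<le> 0\<close>. What remains is the inequality of
  the unary function, with the singleton lists stripped.\<close>

lemma fPol_dual_iff:
  "\<omega> \<in> fPol (dual_dom D \<phi>s) k (dual D \<phi>s) \<longleftrightarrow>
    \<omega> \<in> Pol (dual_dom D \<phi>s) k (dual D \<phi>s) \<rightarrow>\<^sub>E {0..} \<and>
    (\<Sum>g\<in>Pol (dual_dom D \<phi>s) k (dual D \<phi>s). \<omega> g) = 1 \<and>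
    (\<forall>X\<in>nlists k (dual_dom D \<phi>s).
      (\<Sum>g\<in>Pol (dual_dom D \<phi>s) k (dual D \<phi>s). \<omega> g * fin_val (combined_value \<phi>s (g X)))
        \<le> 1 / of_nat k * (\<Sum>i<k. fin_val (combined_value \<phi>s (X ! i))))"
proof -
  let ?D' = "dual_dom D \<phi>s" and ?P = "Pol (dual_dom D \<phi>s) k (dual D \<phi>s)"
  define ineq where "ineq \<phi> Z \<longleftrightarrow>
    (\<Sum>g\<in>?P. \<omega> g * fin_val (cost \<phi> (componentwise g (arity \<phi>) Z)))
      \<le> 1 / of_nat k * (\<Sum>i<k. fin_val (cost \<phi> (Z ! i)))" for \<phi> :: "'a list cost_fun" and Z
  have match: "ineq (match ?D' i j) Z"
    if ij: "i < total_arity \<phi>s" "j < total_arity \<phi>s"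
      and Z: "Z \<in> nlists k (Feas ?D' (match ?D' i j))" for i j Z
  proof -
    have cost0: "fin_val (cost (match ?D' i j) z) = 0" if "z \<in> Feas ?D' (match ?D' i j)" for z
      using that by (auto simp: Feas_def match_def zero_qbar_def split: if_splits)
    have "componentwise g (arity (match ?D' i j)) Z \<in> Feas ?D' (match ?D' i j)"
      if "g \<in> ?P" for g
      using that Z ij unfolding Pol_def dual_def by blast
    moreover have "Z ! l \<in> Feas ?D' (match ?D' i j)" if "l < k" for l
      using that Z by (auto simp: nlists_def)
    ultimately show ?thesis unfolding ineq_def by (simp add: cost0)
  qed
  have unary_cost: "fin_val (cost (dual_unary D \<phi>s) [x]) = fin_val (combined_value \<phi>s x)"
    if "x \<in> ?D'" for x
    using that by (auto simp: dual_unary_def combined_def in_nlists_Suc_iff dual_dom_iff)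
  have unary: "ineq (dual_unary D \<phi>s) (map (\<lambda>x. [x]) X) \<longleftrightarrow>
      (\<Sum>g\<in>?P. \<omega> g * fin_val (combined_value \<phi>s (g X)))
        \<le> 1 / of_nat k * (\<Sum>i<k. fin_val (combined_value \<phi>s (X ! i)))"
    if X: "X \<in> nlists k ?D'" for X
  proof -
    have "componentwise g (arity (dual_unary D \<phi>s)) (map (\<lambda>x. [x]) X) = [g X]" for g
      by (simp add: dual_unary_def componentwise_def o_def)
    moreover have "g X \<in> ?D'" if "g \<in> ?P" for g
      using that X by (auto simp: Pol_dual_iff dest: PiE_mem)
    moreover have "X ! i \<in> ?D'" "map (\<lambda>x. [x]) X ! i = [X ! i]" if "i < k" for i
      using X that by (auto simp: nlists_def)
    ultimately show ?thesis unfolding ineq_def by (simp add: unary_cost)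
  qed
  have "(\<forall>\<phi>\<in>dual D \<phi>s. \<forall>Z\<in>nlists k (Feas ?D' \<phi>). ineq \<phi> Z) \<longleftrightarrow>
      (\<forall>Z\<in>nlists k (Feas ?D' (dual_unary D \<phi>s)). ineq (dual_unary D \<phi>s) Z)"
    using match by (auto simp: dual_def)
  also have "\<dots> \<longleftrightarrow> (\<forall>X\<in>nlists k ?D'. ineq (dual_unary D \<phi>s) (map (\<lambda>x. [x]) X))"
    unfolding Feas_dual_unary nlists_image by simp
  finally show ?thesis using unary unfolding fPol_def ineq_def by auto
qed

section \<open>Splitting the combined inequality into those of the single cost functions\<close>

lemma combined_inequality_iff:
  fixes \<omega> :: "('a list \<Rightarrow> 'a) \<Rightarrow> rat"
  assumes D: "finite D" and k: "k \<ge> 1" and ne: "\<forall>\<phi>\<in>set \<phi>s. Feas D \<phi> \<noteq> {}"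
    and \<omega>0: "\<And>f. f \<in> Pol D k (set \<phi>s) \<Longrightarrow> 0 \<le> \<omega> f"
    and \<omega>1: "(\<Sum>f\<in>Pol D k (set \<phi>s). \<omega> f) = 1"
  shows "(\<forall>\<phi>\<in>set \<phi>s. \<forall>xs\<in>nlists k (Feas D \<phi>).
      (\<Sum>f\<in>Pol D k (set \<phi>s). \<omega> f * fin_val (cost \<phi> (componentwise f (arity \<phi>) xs)))
        \<le> 1 / of_nat k * (\<Sum>i<k. fin_val (cost \<phi> (xs ! i)))) \<longleftrightarrow>
    (\<forall>X\<in>nlists k (dual_dom D \<phi>s).
      (\<Sum>f\<in>Pol D k (set \<phi>s).
          \<omega> f * fin_val (combined_value \<phi>s (componentwise f (total_arity \<phi>s) X)))
        \<le> 1 / of_nat k * (\<Sum>i<k. fin_val (combined_value \<phi>s (X ! i))))"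
proof -
  let ?P = "Pol D k (set \<phi>s)" and ?D' = "dual_dom D \<phi>s" and ?n = "length \<phi>s"
  \<comment> \<open>\<open>L\<close> and \<open>R\<close> are the two sides of the inequality of one
    cost function. Exchanging the sum over operations or arguments with the sum over blocks shows
    that both sides of the combined inequality are sums of these.\<close>
  define L where
    "L \<phi> xs = (\<Sum>f\<in>?P. \<omega> f * fin_val (cost \<phi> (componentwise f (arity \<phi>) xs)))"
    for \<phi> :: "'a cost_fun" and xs
  define R where
    "R \<phi> xs = 1 / of_nat k * (\<Sum>i<k. fin_val (cost \<phi> (xs ! i)))" for \<phi> :: "'a cost_fun" and xs
  have Lsum: "(\<Sum>f\<in>?P. \<omega> f * fin_val (combined_value \<phi>s (componentwise f (total_arity \<phi>s) X)))
      = (\<Sum>p<?n. L (\<phi>s ! p) (map (block \<phi>s p) X))" if X: "X \<in> nlists k ?D'" for X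
  proof -
    have "fin_val (combined_value \<phi>s (componentwise f (total_arity \<phi>s) X)) =
        (\<Sum>p<?n. fin_val (cost (\<phi>s ! p)
          (componentwise f (arity (\<phi>s ! p)) (map (block \<phi>s p) X))))" if "f \<in> ?P" for f
      using fin_val_combined_value_dual_dom[OF componentwise_in_dual_dom[OF that X]]
        block_componentwise[OF _ nlists_dual_dom_length[OF X], where f = f] by simp
    then show ?thesis by (simp add: L_def sum_distrib_left sum.swap[of _ ?P])
  qed
  have Rsum: "1 / of_nat k * (\<Sum>i<k. fin_val (combined_value \<phi>s (X ! i))) =
      (\<Sum>p<?n. R (\<phi>s ! p) (map (block \<phi>s p) X))" if X: "X \<in> nlists k ?D'" for X
  proof -
    have Xi: "X ! i \<in> ?D'" if "i < k" for i using X that by (auto simp: nlists_def)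
    have len: "length X = k" using X by (rule nlistsE_length)
    show ?thesis
      by (simp add: R_def fin_val_combined_value_dual_dom[OF Xi] len sum_distrib_left[symmetric]
          sum.swap[of _ "{..<k}"] del: times_divide_eq_left)
  qed
  have step: "L (\<phi>s ! p) xs \<le> R (\<phi>s ! p) xs"
    if sums: "\<And>X. X \<in> nlists k ?D' \<Longrightarrow> (\<Sum>q<?n. L (\<phi>s ! q) (map (block \<phi>s q) X)) \<le>
        (\<Sum>q<?n. R (\<phi>s ! q) (map (block \<phi>s q) X))"
      and p: "p < ?n" and xs: "xs \<in> nlists k (Feas D (\<phi>s ! p))" for p xs
  proof -
    \<comment> \<open>Minimisers exist because \<open>D\<close> is finite and feasible tuples have a
      fixed length.\<close>
    have "\<exists>x\<in>Feas D \<phi>. \<forall>y\<in>Feas D \<phi>. fin_val (cost \<phi> x) \<le> fin_val (cost \<phi> y)"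
      if "\<phi> \<in> set \<phi>s" for \<phi>
    proof -
      have "finite (Feas D \<phi>)"
        by (rule finite_subset[OF _ finite_lists_length_eq[OF D, of "arity \<phi>"]])
          (auto simp: Feas_def nlists_def)
      then show ?thesis
        using ex_min_if_finite[of "(\<lambda>x. fin_val (cost \<phi> x)) ` Feas D \<phi>"] ne that
        by (force simp: not_less)
    qed
    then obtain a where a: "\<And>\<phi>. \<phi> \<in> set \<phi>s \<Longrightarrow> a \<phi> \<in> Feas D \<phi>"
      and min: "\<And>\<phi> y. \<phi> \<in> set \<phi>s \<Longrightarrow> y \<in> Feas D \<phi> \<Longrightarrow>
        fin_val (cost \<phi> (a \<phi>)) \<le> fin_val (cost \<phi> y)"
      by metis
    obtain X where X: "X \<in> nlists k ?D'" "map (block \<phi>s p) X = xs"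
      and Xq: "\<And>q. q < ?n \<Longrightarrow> q \<noteq> p \<Longrightarrow> map (block \<phi>s q) X = replicate k (a (\<phi>s ! q))"
      using ex_dual_tuple_of_block[OF p xs, of "\<lambda>q. a (\<phi>s ! q)"] a nth_mem by metis
    have RL: "R (\<phi>s ! q) (map (block \<phi>s q) X) \<le> L (\<phi>s ! q) (map (block \<phi>s q) X)"
      if q: "q < ?n" "q \<noteq> p" for q
    proof -
      let ?\<phi> = "\<phi>s ! q"
      have mem: "?\<phi> \<in> set \<phi>s" using q by simp
      \<comment> \<open>The mean of \<open>k\<close> copies of the minimal cost is that cost; as
        \<open>\<omega>\<close> has total mass 1, it is also its own
        \<open>\<omega>\<close>-average.\<close>
      have "R ?\<phi> (map (block \<phi>s q) X) = (\<Sum>f\<in>?P. \<omega> f * fin_val (cost ?\<phi> (a ?\<phi>)))"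
        using k \<omega>1 by (simp add: Xq[OF q] R_def sum_distrib_right[symmetric])
      also have "\<dots> \<le> L ?\<phi> (map (block \<phi>s q) X)"
        unfolding L_def
      proof (intro sum_mono mult_left_mono \<omega>0 min[OF mem])
        \<comment> \<open>A polymorphism maps the constant tuple of minimisers to a feasible tuple,
          whose cost cannot be below the minimum.\<close>
        fix f assume "f \<in> ?P"
        then show "componentwise f (arity ?\<phi>) (map (block \<phi>s q) X) \<in> Feas D ?\<phi>"
          using map_block_in_nlists[OF X(1) q(1)] mem by (auto simp: Pol_def)
      qed
      finally show ?thesis .
    qed
    \<comment> \<open>The blocks other than \<open>p\<close> contribute at least as much on the left
      as on the right of the combined inequality, so cancelling them leaves the inequality for block
      \<open>p\<close>.\<close>
    have "(\<Sum>q\<in>{..<?n} - {p}. R (\<phi>s ! q) (map (block \<phi>s q) X)) \<le>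
        (\<Sum>q\<in>{..<?n} - {p}. L (\<phi>s ! q) (map (block \<phi>s q) X))"
      by (intro sum_mono RL) auto
    then show ?thesis
      using sums[OF X(1)] p X(2) by (simp add: sum.remove[of "{..<?n}" p])
  qed
  have "(\<forall>\<phi>\<in>set \<phi>s. \<forall>xs\<in>nlists k (Feas D \<phi>). L \<phi> xs \<le> R \<phi> xs) \<longleftrightarrow>
      (\<forall>X\<in>nlists k ?D'. (\<Sum>p<?n. L (\<phi>s ! p) (map (block \<phi>s p) X)) \<le>
        (\<Sum>p<?n. R (\<phi>s ! p) (map (block \<phi>s p) X)))"
  proof (intro iffI ballI)
    fix X assume "\<forall>\<phi>\<in>set \<phi>s. \<forall>xs\<in>nlists k (Feas D \<phi>). L \<phi> xs \<le> R \<phi> xs" "X \<in> nlists k ?D'"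
    then show "(\<Sum>p<?n. L (\<phi>s ! p) (map (block \<phi>s p) X)) \<le>
        (\<Sum>p<?n. R (\<phi>s ! p) (map (block \<phi>s p) X))"
      by (intro sum_mono) (simp add: map_block_in_nlists)
  next
    fix \<phi> xs assume "\<forall>X\<in>nlists k ?D'. (\<Sum>p<?n. L (\<phi>s ! p) (map (block \<phi>s p) X)) \<le>
        (\<Sum>p<?n. R (\<phi>s ! p) (map (block \<phi>s p) X))" "\<phi> \<in> set \<phi>s" "xs \<in> nlists k (Feas D \<phi>)"
    then show "L \<phi> xs \<le> R \<phi> xs" using step by (auto simp: in_set_conv_nth)
  qed
  then show ?thesis
    unfolding L_def[symmetric] R_def[symmetric]
    by (simp add: Lsum Rsum del: times_divide_eq_left cong: ball_cong)
qed

text \<open>Stated for a linked pair of weights rather than for a map, so that one lemma serves for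
  transport in both directions.\<close>

lemma fPol_iff_fPol_dual:
  assumes D: "finite D" and k: "k \<ge> 1" and ne: "\<forall>\<phi>\<in>set \<phi>s. Feas D \<phi> \<noteq> {}"
    and bij: "bij_betw (dual_op D \<phi>s k) (Pol D k (set \<phi>s)) (Pol (dual_dom D \<phi>s) k (dual D \<phi>s))"
    and \<omega>: "\<omega> \<in> Pol D k (set \<phi>s) \<rightarrow>\<^sub>E {0..}"
    and \<omega>d: "\<omega>d \<in> Pol (dual_dom D \<phi>s) k (dual D \<phi>s) \<rightarrow>\<^sub>E {0..}"
    and eq: "\<And>f. f \<in> Pol D k (set \<phi>s) \<Longrightarrow> \<omega>d (dual_op D \<phi>s k f) = \<omega> f"
  shows "\<omega> \<in> fPol D k (set \<phi>s) \<longleftrightarrow> \<omega>d \<in> fPol (dual_dom D \<phi>s) k (dual D \<phi>s)"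
proof -
  let ?P = "Pol D k (set \<phi>s)" and ?Pd = "Pol (dual_dom D \<phi>s) k (dual D \<phi>s)"
  have reindex: "(\<Sum>g\<in>?Pd. \<omega>d g * h g) = (\<Sum>f\<in>?P. \<omega> f * h (dual_op D \<phi>s k f))" for h
    using sum.reindex_bij_betw[OF bij, of "\<lambda>g. \<omega>d g * h g"] eq by simp
  have total: "sum \<omega>d ?Pd = sum \<omega> ?P" using reindex[of "\<lambda>_. 1"] by simp
  have \<omega>0: "0 \<le> \<omega> f" if "f \<in> ?P" for f using PiE_mem[OF \<omega> that] by simp
  have op: "dual_op D \<phi>s k f X = componentwise f (total_arity \<phi>s) X"
    if "X \<in> nlists k (dual_dom D \<phi>s)" for f X
    using that by (simp add: dual_op_def)
  show ?thesis
  \<comment> \<open>The comparison of inequalities averages with total mass 1. If the mass differs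
    from 1, neither weight is a fractional polymorphism, as the bijection of operations preserves
    the mass.\<close>
  proof (cases "sum \<omega> ?P = 1")
    case True
    then show ?thesis
      using combined_inequality_iff[OF D k ne \<omega>0 True] \<omega> \<omega>d total
      unfolding fPol_dual_iff reindex by (simp add: fPol_def op cong: ball_cong)
  next
    case False
    then show ?thesis using total by (simp add: fPol_def)
  qed
qed

theorem theorem4p10:
  fixes D :: "'a set" and \<Gamma> :: "'a cost_fun set" and \<phi>s :: "'a cost_fun list" and k :: nat
  assumes "finite D"
    and "valued_constraint_language D \<Gamma>"
    and "finite \<Gamma>"
    and "set \<phi>s = \<Gamma>" and "distinct \<phi>s"
    and "\<forall>\<phi>\<in>\<Gamma>. Feas D \<phi> \<noteq> {}"
    and "k \<ge> 1"
    and "inj_on (dual_op D \<phi>s k) (Pol D k \<Gamma>)"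
  shows "bij_betw (dual_op D \<phi>s k) (Pol D k \<Gamma>) (Pol (dual_dom D \<phi>s) k (dual D \<phi>s)) \<and>
    (\<exists>\<Omega>. bij_betw \<Omega> (fPol D k \<Gamma>) (fPol (dual_dom D \<phi>s) k (dual D \<phi>s)) \<and>
         (\<forall>\<omega>\<in>fPol D k \<Gamma>. \<forall>f\<in>Pol D k \<Gamma>. \<Omega> \<omega> (dual_op D \<phi>s k f) = \<omega> f))"
proof -
  let ?P = "Pol D k \<Gamma>" and ?Pd = "Pol (dual_dom D \<phi>s) k (dual D \<phi>s)"
    and ?h = "dual_op D \<phi>s k"
  let ?F = "fPol D k \<Gamma>" and ?Fd = "fPol (dual_dom D \<phi>s) k (dual D \<phi>s)"
  have bij: "bij_betw ?h ?P ?Pd" using bij_betw_dual_op assms by blast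
  \<comment> \<open>Weights are carried along the bijection of operations by \<open>\<Omega>\<close>
    and back by \<open>\<Omega>'\<close>. The restricted abstractions make the results extensional,
    as \<open>fPol\<close> requires.\<close>
  define \<Omega> where "\<Omega> \<omega> = (\<lambda>g\<in>?Pd. \<omega> (inv_into ?P ?h g))" for \<omega> :: "('a list \<Rightarrow> 'a) \<Rightarrow> rat"
  define \<Omega>' where "\<Omega>' \<omega> = (\<lambda>f\<in>?P. \<omega> (?h f))" for \<omega> :: "('a list list \<Rightarrow> 'a list) \<Rightarrow> rat"
  have h: "?h f \<in> ?Pd" "inv_into ?P ?h (?h f) = f" if "f \<in> ?P" for f
    using that bij by (auto simp: bij_betw_inv_into_left dest: bij_betwE)
  have h': "inv_into ?P ?h g \<in> ?P" "?h (inv_into ?P ?h g) = g" if "g \<in> ?Pd" for g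
    using that bij by (auto simp: bij_betw_inv_into_right dest: bij_betwE[OF bij_betw_inv_into])
  have F: "\<omega> \<in> ?P \<rightarrow>\<^sub>E {0..}" if "\<omega> \<in> ?F" for \<omega> using that by (simp add: fPol_def)
  have Fd: "\<omega> \<in> ?Pd \<rightarrow>\<^sub>E {0..}" if "\<omega> \<in> ?Fd" for \<omega> using that by (simp add: fPol_def)
  note iff = fPol_iff_fPol_dual[of D k \<phi>s, unfolded \<open>set \<phi>s = \<Gamma>\<close>, OF assms(1,7,6) bij]
  have \<Omega>_h: "\<Omega> \<omega> (?h f) = \<omega> f" if "f \<in> ?P" for \<omega> f using that h by (simp add: \<Omega>_def)
  have "bij_betw \<Omega> ?F ?Fd"
  proof (rule bij_betw_byWitness[where f' = \<Omega>'])
    show "\<forall>\<omega>\<in>?F. \<Omega>' (\<Omega> \<omega>) = \<omega>"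
    proof
      fix \<omega> assume "\<omega> \<in> ?F"
      then show "\<Omega>' (\<Omega> \<omega>) = \<omega>"
        \<comment> \<open>Outside the set of polymorphisms both sides are \<open>undefined\<close>,
          so they agree as HOL functions.\<close>
        using PiE_arb[OF F, of \<omega>] by (intro ext) (simp add: \<Omega>'_def \<Omega>_h)
    qed
    show "\<forall>\<omega>\<in>?Fd. \<Omega> (\<Omega>' \<omega>) = \<omega>"
    proof
      fix \<omega> assume "\<omega> \<in> ?Fd"
      then show "\<Omega> (\<Omega>' \<omega>) = \<omega>"
        using PiE_arb[OF Fd, of \<omega>] h' by (intro ext) (simp add: \<Omega>'_def \<Omega>_def)
    qed
    show "\<Omega> ` ?F \<subseteq> ?Fd"
    proof (intro image_subsetI)
      fix \<omega> assume \<omega>: "\<omega> \<in> ?F"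
      have "\<Omega> \<omega> \<in> ?Pd \<rightarrow>\<^sub>E {0..}"
        using PiE_mem[OF F[OF \<omega>]] h' by (auto simp: \<Omega>_def)
      then show "\<Omega> \<omega> \<in> ?Fd" using iff[OF F[OF \<omega>]] \<Omega>_h \<omega> by blast
    qed
    show "\<Omega>' ` ?Fd \<subseteq> ?F"
    proof (intro image_subsetI)
      fix \<omega> assume \<omega>: "\<omega> \<in> ?Fd"
      have "\<Omega>' \<omega> \<in> ?P \<rightarrow>\<^sub>E {0..}"
        using PiE_mem[OF Fd[OF \<omega>]] h by (auto simp: \<Omega>'_def)
      moreover have "\<omega> (?h f) = \<Omega>' \<omega> f" if "f \<in> ?P" for f using that by (simp add: \<Omega>'_def)
      ultimately show "\<Omega>' \<omega> \<in> ?F" using iff[OF _ Fd[OF \<omega>]] \<omega> by blast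
    qed
  qed
  then show ?thesis using bij \<Omega>_h by blast
qed

end
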